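(* For any generalized snake word $\mathbf{w}$ of length $n>0$ and for all $k\ge0$, the following inequality holds: $$[z^k]\,h^*(\varphi_i(\mathbf{w});z)\le[z^k]\,h^*(\mathbf{w};z),$$ whenever $w_{i-1}=w_i$ or $i=1$. Equality occurs only when $i=1$. Here $\varphi_i$ is the swap operation, and letters of $\mathbf{w}$ are indexed from left to right with the empty letter $\varepsilon$ having index $1$.
   Context: Generalized snake words: for $n\ge 0$, a generalized snake word of length $n$ is a word consisting of the empty letter $\varepsilon$ followed by $n$ letters from $\{L,R\}$. In the claim and in the swap operation the letters are indexed from left to right in increasing order with $\varepsilon$ having index $1$. In the definition of the poset below, the letters are instead written $v_0v_1\cdots v_n$ with $v_0=\varepsilon$. Generalized snake posets: $P(\mathbf{w})$ is defined recursively. $P(\varepsilon)$ is the poset on $\{0,1,2,3\}$ with cover relations $1\prec 0$, $2\prec 0$, $3\prec 1$, $3\prec 2$. For $n\ge 1$, $P(v_0v_1\cdots v_n)$ is $P(v_0\cdots v_{n-1})\cup\{2n+2,2n+3\}$ with the added cover relations $2n+3\prec 2n+1$, $2n+3\prec 2n+2$, and: $2n+2\prec 2n-1$ if ($n=1$ and $v_1=L$) or ($n\ge2$ and $v_{n-1}v_n\in\{RL,LR\}$); $2n+2\prec 2n$ if ($n=1$ and $v_1=R$) or ($n\ge 2$ and $v_{n-1}v_n\in\{LL,RR\}$). Order polytope: for a finite poset $P$, $\mathcal{O}(P)=\{x\in[0,1]^P: x_a\le x_b \text{ whenever } a<_P b\}\subset\mathbb{R}^P$, a lattice polytope of dimension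 $|P|$. $h^*$-polynomial: $h^*(\mathbf{w};z)$ is the polynomial defined by $\sum_{t\ge0}|t\,\mathcal{O}(P(\mathbf{w}))\cap\mathbb{Z}^{P(\mathbf{w})}|\,z^t=\dfrac{h^*(\mathbf{w};z)}{(1-z)^{d+1}}$ with $d=|P(\mathbf{w})|=2n+4$. $[z^k]f$ denotes the coefficient of $z^k$ in $f$. Swap operation: $\varphi_i$ maps generalized snake words of length $n$ to generalized snake words of length $n$; $\varphi_i(\mathbf{w})$ is obtained from $\mathbf{w}$ by swapping all letters with indices greater than or equal to $i$ from $R$ to $L$ and from $L$ to $R$ (the empty letter $\varepsilon$, of index $1$, is unaffected). Example: $\varphi_7(\varepsilon RRLLLRRRRLL)=\varepsilon RRLLLLLLLRR$. *)

theory Defs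
  imports
    Complex_Main
    "HOL-Library.FuncSet"
    "HOL-Computational_Algebra.Polynomial_FPS"
begin

datatype letter = Eps | L | R

definition gen_snake_word :: "nat \<Rightarrow> letter list \<Rightarrow> bool" where
  "gen_snake_word n w \<longleftrightarrow>
     length w = n + 1 \<and> w ! 0 = Eps \<and> (\<forall>k\<in>{1..n}. w ! k \<in> {L, R})"

text \<open>
  Letters carry two index conventions. In the poset a word is \<open>v\<^sub>0 v\<^sub>1 \<dots> v\<^sub>n\<close>, where \<open>v\<^sub>k\<close> is
  \<open>v ! k\<close>. For the swap operation indices start at 1, so the letter of index \<open>i \<ge> 1\<close> is
  \<open>w ! (i - 1)\<close> and the empty letter has index 1.
\<close>

definition letter_at :: "letter list \<Rightarrow> nat \<Rightarrow> letter" where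
  "letter_at w i = w ! (i - 1)"

fun flip_letter :: "letter \<Rightarrow> letter" where
  "flip_letter Eps = Eps"
| "flip_letter L = R"
| "flip_letter R = L"

definition swap :: "nat \<Rightarrow> letter list \<Rightarrow> letter list" where
  "swap i w = map (\<lambda>j. if i \<le> j then flip_letter (letter_at w j) else letter_at w j)
                  [1..<length w + 1]"

text \<open>
  \<open>snake_covers v n\<close> is the set of cover relations \<open>a \<prec> b\<close>, as pairs \<open>(a, b)\<close>, of the poset of
  \<open>v\<^sub>0 v\<^sub>1 \<dots> v\<^sub>n\<close>; only the letters of that prefix are consulted.
\<close>

primrec snake_covers :: "letter list \<Rightarrow> nat \<Rightarrow> (nat \<times> nat) set" where
  "snake_covers v 0 = {(1, 0), (2, 0), (3, 1), (3, 2)}"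
| "snake_covers v (Suc m) =
     (let n = Suc m in
      snake_covers v m
      \<union> {(2*n + 3, 2*n + 1), (2*n + 3, 2*n + 2)}
      \<union> (if (n = 1 \<and> v ! 1 = L) \<or> (n \<ge> 2 \<and> (v ! (n - 1), v ! n) \<in> {(R, L), (L, R)})
         then {(2*n + 2, 2*n - 1)} else {})
      \<union> (if (n = 1 \<and> v ! 1 = R) \<or> (n \<ge> 2 \<and> (v ! (n - 1), v ! n) \<in> {(L, L), (R, R)})
         then {(2*n + 2, 2*n)} else {}))"

primrec snake_elements :: "nat \<Rightarrow> nat set" where
  "snake_elements 0 = {0, 1, 2, 3}"
| "snake_elements (Suc m) = (let n = Suc m in snake_elements m \<union> {2*n + 2, 2*n + 3})"

definition snake_carrier :: "letter list \<Rightarrow> nat set" where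
  "snake_carrier w = snake_elements (length w - 1)"

definition snake_less :: "letter list \<Rightarrow> (nat \<times> nat) set" where
  "snake_less w = (snake_covers w (length w - 1))\<^sup>+"

text \<open>
  A finite poset is given by its ground set \<open>A\<close> and its strict order \<open>r\<close>. Points of \<open>\<real>\<^sup>A\<close> are
  functions that are \<open>undefined\<close> outside \<open>A\<close> (as in \<^const>\<open>PiE\<close>), so that distinct functions are
  distinct points.
\<close>

definition order_polytope :: "'a set \<Rightarrow> ('a \<times> 'a) set \<Rightarrow> ('a \<Rightarrow> real) set" where
  "order_polytope A r =
     {x \<in> A \<rightarrow>\<^sub>E {0..1}. \<forall>a\<in>A. \<forall>b\<in>A. (a, b) \<in> r \<longrightarrow> x a \<le> x b}"

definition dilate :: "'a set \<Rightarrow> nat \<Rightarrow> ('a \<Rightarrow> real) set \<Rightarrow> ('a \<Rightarrow> real) set" where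
  "dilate A t S = (\<lambda>x. \<lambda>a\<in>A. real t * x a) ` S"

definition ehrhart_count :: "'a set \<Rightarrow> ('a \<times> 'a) set \<Rightarrow> nat \<Rightarrow> nat" where
  "ehrhart_count A r t = card (dilate A t (order_polytope A r) \<inter> (A \<rightarrow>\<^sub>E \<int>))"

text \<open>The dimension of the order polytope of a poset on \<open>A\<close> is \<open>card A\<close>.\<close>

definition order_polytope_h_star :: "'a set \<Rightarrow> ('a \<times> 'a) set \<Rightarrow> real poly" where
  "order_polytope_h_star A r =
     (THE h. Abs_fps (\<lambda>t. real (ehrhart_count A r t))
             = fps_of_poly h / (1 - fps_X) ^ (card A + 1))"

definition h_star :: "letter list \<Rightarrow> real poly" where
  "h_star w = order_polytope_h_star (snake_carrier w) (snake_less w)"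

end

theory Submission
  imports Defs "HOL-Combinatorics.Transposition"
begin

text \<open>
  For \<open>i \<ge> 3\<close>, put \<open>m = i - 1\<close>. The poset of a word \<open>v\<^sub>0 v\<^sub>1 \<dots> v\<^sub>n\<close> depends only on the element
  below which each \<open>2*k + 2\<close> is hung. For \<open>k \<ge> 2\<close> it is \<open>2*k\<close> or \<open>2*k - 1\<close> according to whether the
  letters of positions \<open>k - 1\<close> and \<open>k\<close> agree; for \<open>k = 1\<close> the letter of position 1 decides. Flipping a
  final segment of the word changes agreement at a single place, so the swap only moves
  the element \<open>c = 2*m + 2\<close> from below \<open>b = 2*m\<close> to below \<open>a = 2*m - 1\<close>; all other cover relations
  stay. The elements \<open>a\<close> and \<open>b\<close> are almost twins: both cover \<open>2*m + 1\<close>, both lie below a common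
  element \<open>p\<close>, and apart from \<open>c\<close> their only difference is that \<open>a\<close> is covered by one more element \<open>q\<close>.
  
  The lattice points of the \<open>t\<close>-th dilate are the order-preserving maps \<open>f\<close> into \<open>{0..t}\<close>. Among those
  with \<open>f b \<le> f q\<close> the two elements are indistinguishable, and exchanging their values is a bijection
  between the maps for the two posets. If \<open>f b > f q\<close>, then \<open>f c \<le> f a \<le> f q < f b\<close>, so every such
  map for the second poset is one for the first. The surplus of the first poset therefore consists of its
  maps with \<open>f q < f b\<close> and \<open>f a < f c\<close> (lemma \<open>card_p_partitions_exchange\<close>).
  
  The surplus is again a set of \<open>(P, \<omega>)\<close>-partitions in the sense of Stanley: order-preserving maps in which
  some inequalities are strict, the strictness being dictated by a labelling. Here the labels are the
  elements themselves in reverse numerical order, and both strict relations increase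
  numerically whereas all cover relations decrease. By Stanley's theorem the counting series of
  \<open>(P, \<omega>)\<close>-partitions is \<open>W(z) / (1 - z)^(d + 1)\<close> with a polynomial \<open>W\<close> that has nonnegative coefficients
  (lemma \<open>p_partitions_series\<close>). Applied to the snake posets, this identifies their
  \<open>h\<^sup>*\<close>-polynomials; applied to the surplus, it shows that their difference is coefficientwise
  nonnegative. The difference is not zero because some 0/1-valued map is in the surplus.
  
  The case \<open>i = 2\<close> cannot occur, since the empty letter differs from every other letter. For \<open>i = 1\<close>
  all agreements are preserved, and the two posets differ by the exchange of the elements 1 and 2.
\<close>

section \<open>\<open>(P, \<omega>)\<close>-partitions\<close>

text \<open>
  The order of the values of \<open>f\<close>, with ties broken by the reverse order of the arguments. It is
  a strict linear order for every \<open>f\<close>; a constraint \<open>precedes f u v\<close> means \<open>f u \<le> f v\<close> if \<open>u > v\<close>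
  and \<open>f u < f v\<close> if \<open>u < v\<close>. The reverse order suits the snake posets, whose covers \<open>u \<prec> v\<close>
  have \<open>u > v\<close>.
\<close>

definition precedes :: "('a::linorder \<Rightarrow> nat) \<Rightarrow> 'a \<Rightarrow> 'a \<Rightarrow> bool" where
  "precedes f u v \<longleftrightarrow> f u < f v \<or> (f u = f v \<and> v < u)"

definition p_partitions :: "'a::linorder set \<Rightarrow> ('a \<times> 'a) set \<Rightarrow> nat \<Rightarrow> ('a \<Rightarrow> nat) set" where
  "p_partitions A C t = {f \<in> A \<rightarrow>\<^sub>E {..t}. \<forall>(u, v)\<in>C. precedes f u v}"

lemma precedes_descending: "v < u \<Longrightarrow> precedes f u v \<longleftrightarrow> f u \<le> f v"
  by (auto simp: precedes_def)

lemma precedes_ascending: "u < v \<Longrightarrow> precedes f u v \<longleftrightarrow> f u < f v"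
  by (auto simp: precedes_def)

lemma precedes_trans: "precedes f u v \<Longrightarrow> precedes f v w \<Longrightarrow> precedes f u w"
  by (auto simp: precedes_def)

lemma precedes_asym: "precedes f u v \<Longrightarrow> \<not> precedes f v u"
  by (auto simp: precedes_def)

lemma precedes_total: "u \<noteq> v \<Longrightarrow> precedes f u v \<or> precedes f v u"
  by (auto simp: precedes_def)

lemma sorted_wrt_precedes_cong:
  "(\<And>u. u \<in> set xs \<Longrightarrow> f u = g u) \<Longrightarrow>
    sorted_wrt (precedes f) xs = sorted_wrt (precedes g) xs"
  by (induction xs) (auto simp: precedes_def)

lemma finite_p_partitions: "finite A \<Longrightarrow> finite (p_partitions A C t)"
  unfolding p_partitions_def
  by (rule finite_subset[of _ "A \<rightarrow>\<^sub>E {..t}"]) (auto intro!: finite_PiE)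

section \<open>Decomposition into chains\<close>

text \<open>
  Insertion into a sorted list: a new element goes between its predecessors and its successors.
\<close>

lemma ex_sorted_wrt_precedes:
  assumes "finite A"
  shows "\<exists>xs. distinct xs \<and> set xs = A \<and> sorted_wrt (precedes f) xs"
  using assms
proof (induction A rule: finite_induct)
  case empty
  then show ?case by simp
next
  case (insert x A)
  then obtain xs where xs: "distinct xs" "set xs = A" "sorted_wrt (precedes f) xs" by blast
  let ?ys = "filter (\<lambda>v. precedes f v x) xs @ x # filter (\<lambda>v. precedes f x v) xs"
  have "distinct ?ys"
    using xs insert.hyps by (auto dest: precedes_asym)
  moreover have "set ?ys = insert x A"
    using xs insert.hyps by (auto dest: precedes_total)
  moreover have "sorted_wrt (precedes f) ?ys"
    using xs(3) by (auto simp: sorted_wrt_append sorted_wrt_filter intro: precedes_trans)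
  ultimately show ?case by blast
qed

lemma sorted_wrt_precedes_unique:
  assumes "sorted_wrt (precedes f) xs" "sorted_wrt (precedes f) ys" "set xs = set ys"
  shows "xs = ys"
  using assms
proof (induction xs arbitrary: ys)
  case Nil
  then show ?case by simp
next
  case (Cons x xs)
  then obtain y zs where ys: "ys = y # zs" by (cases ys) auto
  have "x = y"
  proof (rule ccontr)
    assume "x \<noteq> y"
    then have "x \<in> set zs" "y \<in> set xs" using Cons.prems(3) unfolding ys by auto
    then show False using Cons.prems(1,2) precedes_asym[of f x y] unfolding ys by auto
  qed
  moreover have "x \<notin> set xs" "y \<notin> set zs"
    using Cons.prems precedes_asym[of f] unfolding ys by (auto, metis+)
  ultimately have "set xs = set zs"
    using Cons.prems(3) unfolding ys by (simp add: insert_ident)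
  then show ?case
    using Cons.prems(1,2) Cons.IH[of zs] \<open>x = y\<close> unfolding ys by simp
qed

text \<open>
  The maps whose arguments, listed by increasing value, form the given list: the
  \<open>(P, \<omega>)\<close>-partitions of a chain.
\<close>

definition chain_partitions :: "'a::linorder list \<Rightarrow> nat \<Rightarrow> ('a \<Rightarrow> nat) set" where
  "chain_partitions xs t = {f \<in> set xs \<rightarrow>\<^sub>E {..t}. sorted_wrt (precedes f) xs}"

lemma finite_chain_partitions: "finite (chain_partitions xs t)"
  unfolding chain_partitions_def
  by (rule finite_subset[of _ "set xs \<rightarrow>\<^sub>E {..t}"]) (auto intro!: finite_PiE)

lemma sorted_wrt_precedes_le_last:
  assumes "sorted_wrt (precedes f) ys" "y \<in> set ys"
  shows "f y \<le> f (last ys)"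
  using assms
proof (induction ys)
  case (Cons z ys)
  then show ?case by (cases "ys = []") (auto simp: precedes_def dest: bspec[OF _ last_in_set])
qed simp

lemma sorted_wrt_precedes_snoc:
  assumes "ys \<noteq> []" "sorted_wrt (precedes f) ys"
  shows "sorted_wrt (precedes f) (ys @ [x]) \<longleftrightarrow> precedes f (last ys) x"
proof -
  have "precedes f y x" if "y \<in> set ys" "precedes f (last ys) x" for y
  proof -
    have "ys = butlast ys @ [last ys]" using assms by simp
    then have "y = last ys \<or> precedes f y (last ys)"
      using assms(2) that(1) by (metis Un_iff empty_iff empty_set set_ConsD set_append
          sorted_wrt_append list.set_intros(1))
    then show ?thesis using that(2) precedes_trans by blast
  qed
  then show ?thesis using assms by (auto simp: sorted_wrt_append)
qed

text \<open>
  Once the topmost value is fixed as \<open>t\<close>, only the bound on the rest of the chain remains: \<open>t\<close> for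
  a weak last step and \<open>t - 1\<close> for a strict one. For \<open>t = 0\<close> a strict step leaves no room.
\<close>

lemma card_chain_partitions_with_max:
  assumes "distinct (ys @ [x])"
  shows "card {f \<in> chain_partitions (ys @ [x]) t. f x = t} =
    (if ys \<noteq> [] \<and> last ys < x then if t = 0 then 0 else card (chain_partitions ys (t - 1))
     else card (chain_partitions ys t))"
proof -
  \<comment> \<open>The possible restrictions of such maps to \<open>ys\<close>.\<close>
  define S where "S = {g \<in> chain_partitions ys t. ys \<noteq> [] \<and> last ys < x \<longrightarrow> g (last ys) < t}"
  have x: "x \<notin> set ys" using assms by simp
  have last: "ys \<noteq> [] \<Longrightarrow> last ys \<noteq> x" using x by auto
  have upd: "sorted_wrt (precedes (g(x := s))) ys = sorted_wrt (precedes g) ys" for g s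
    by (rule sorted_wrt_precedes_cong) (use x in auto)
  have res: "sorted_wrt (precedes (restrict g (set ys))) ys = sorted_wrt (precedes g) ys" for g
    by (rule sorted_wrt_precedes_cong) auto
  have "bij_betw (\<lambda>g. g(x := t)) S {f \<in> chain_partitions (ys @ [x]) t. f x = t}"
  proof (rule bij_betwI[where g = "\<lambda>f. restrict f (set ys)"])
    show "(\<lambda>g. g(x := t)) \<in> S \<rightarrow> {f \<in> chain_partitions (ys @ [x]) t. f x = t}"
    proof
      fix g assume g: "g \<in> S"
      have bnd: "g \<in> set ys \<rightarrow>\<^sub>E {..t}" and srt: "sorted_wrt (precedes g) ys"
        using g by (auto simp: S_def chain_partitions_def)
      have "sorted_wrt (precedes (g(x := t))) (ys @ [x])"
      proof (cases "ys = []")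
        case False
        have "g (last ys) \<le> t" using bnd False by (auto simp: PiE_iff)
        then have "precedes (g(x := t)) (last ys) x"
          using g False last[OF False] by (auto simp: precedes_def S_def)
        then show ?thesis
          using sorted_wrt_precedes_snoc[OF False, of "g(x := t)"] srt by (simp add: upd)
      qed simp
      moreover have "g(x := t) \<in> set (ys @ [x]) \<rightarrow>\<^sub>E {..t}"
        using bnd by (auto simp: PiE_iff extensional_def)
      ultimately show "g(x := t) \<in> {f \<in> chain_partitions (ys @ [x]) t. f x = t}"
        by (simp add: chain_partitions_def)
    qed
    show "(\<lambda>f. restrict f (set ys)) \<in> {f \<in> chain_partitions (ys @ [x]) t. f x = t} \<rightarrow> S"
      by (auto simp: S_def chain_partitions_def PiE_iff res sorted_wrt_append precedes_def
          dest!: last_in_set)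
    show "restrict (g(x := t)) (set ys) = g" if "g \<in> S" for g
      using that x by (auto simp: S_def chain_partitions_def PiE_iff extensional_def fun_eq_iff)
    show "(restrict f (set ys))(x := t) = f"
      if "f \<in> {f \<in> chain_partitions (ys @ [x]) t. f x = t}" for f
      using that by (auto simp: chain_partitions_def PiE_iff extensional_def fun_eq_iff)
  qed
  then have "card {f \<in> chain_partitions (ys @ [x]) t. f x = t} = card S"
    by (simp add: bij_betw_same_card)
  moreover have "S = (if t = 0 then {} else chain_partitions ys (t - 1))"
    if "ys \<noteq> []" "last ys < x"
  proof -
    have "g \<in> set ys \<rightarrow>\<^sub>E {..t - 1} \<longleftrightarrow> g \<in> set ys \<rightarrow>\<^sub>E {..t} \<and> g (last ys) < t"
      if "sorted_wrt (precedes g) ys" "t \<noteq> 0" for g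
    proof
      assume "g \<in> set ys \<rightarrow>\<^sub>E {..t - 1}"
      then have "\<forall>u\<in>set ys. g u < t" "g \<in> extensional (set ys)"
        using that(2) by (auto simp: PiE_iff)
      then show "g \<in> set ys \<rightarrow>\<^sub>E {..t} \<and> g (last ys) < t"
        using \<open>ys \<noteq> []\<close> by (auto simp: PiE_iff less_imp_le)
    next
      assume "g \<in> set ys \<rightarrow>\<^sub>E {..t} \<and> g (last ys) < t"
      moreover have "g u \<le> g (last ys)" if "u \<in> set ys" for u
        using sorted_wrt_precedes_le_last[OF \<open>sorted_wrt (precedes g) ys\<close> that] .
      ultimately show "g \<in> set ys \<rightarrow>\<^sub>E {..t - 1}"
        by (fastforce simp: PiE_iff)
    qed
    then show ?thesis using that by (auto simp: S_def chain_partitions_def)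
  qed
  moreover have "S = chain_partitions ys t" if "\<not> (ys \<noteq> [] \<and> last ys < x)"
    using that by (auto simp: S_def)
  ultimately show ?thesis by auto
qed

text \<open>
  The last element carries the maximum, so its value decides whether \<open>f\<close> is already bounded by
  \<open>t - 1\<close>. On generating functions this difference in \<open>t\<close> is multiplication by \<open>1 - z\<close>.
\<close>

lemma card_chain_partitions_snoc:
  "card (chain_partitions (ys @ [x]) t) =
    (if t = 0 then 0 else card (chain_partitions (ys @ [x]) (t - 1)))
    + card {f \<in> chain_partitions (ys @ [x]) t. f x = t}"
proof -
  let ?M = "chain_partitions (ys @ [x])"
  have le: "f u \<le> f x" if "f \<in> ?M t" "u \<in> set (ys @ [x])" for f u t
    using sorted_wrt_precedes_le_last[of f "ys @ [x]" u] that by (simp add: chain_partitions_def)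
  have "?M t - {f. f x = t} = (if t = 0 then {} else ?M (t - 1))"
  proof (cases "t = 0")
    case True
    then show ?thesis by (auto simp: chain_partitions_def PiE_iff)
  next
    case False
    have "f \<in> ?M (t - 1)" if f: "f \<in> ?M t" "f x \<noteq> t" for f
    proof -
      have "f x < t" using f by (force simp: chain_partitions_def PiE_iff)
      then show ?thesis using le[OF f(1)] f(1)
        by (fastforce simp: chain_partitions_def PiE_iff)
    qed
    moreover have "f \<in> ?M t \<and> f x \<noteq> t" if "f \<in> ?M (t - 1)" for f
      using that False by (force simp: chain_partitions_def PiE_iff)
    ultimately show ?thesis using False by auto
  qed
  moreover have "card (?M t) = card (?M t - {f. f x = t}) + card (?M t \<inter> {f. f x = t})"
    by (metis add.commute card_Int_Diff finite_chain_partitions)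
  ultimately show ?thesis by (auto simp: Int_def)
qed

text \<open>
  Each element added to the chain contributes a factor \<open>1 / (1 - z)\<close>, and each strict step a further
  factor \<open>z\<close>. Thus \<open>k\<close> is the number of strict steps, that is, of descents of the list for the labelling.
\<close>

lemma chain_partitions_series:
  "distinct xs \<Longrightarrow> \<exists>k. Abs_fps (\<lambda>t. real (card (chain_partitions xs t))) * (1 - fps_X) ^ (length xs + 1)
     = fps_X ^ k"
proof (induction xs rule: rev_induct)
  case Nil
  have "card (chain_partitions [] t) = 1" for t
    by (simp add: chain_partitions_def)
  then have "Abs_fps (\<lambda>t. real (card (chain_partitions [] t))) * (1 - fps_X) = 1"
    by (auto simp: fps_eq_iff algebra_simps)
  then show ?case by (auto intro!: exI[of _ 0])
next
  case (snoc x ys)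
  then obtain k where k: "Abs_fps (\<lambda>t. real (card (chain_partitions ys t)))
      * (1 - fps_X) ^ (length ys + 1) = fps_X ^ k" by auto
  define e :: nat where "e = (if ys \<noteq> [] \<and> last ys < x then 1 else 0)"
  have "Abs_fps (\<lambda>t. real (card (chain_partitions (ys @ [x]) t))) * (1 - fps_X) =
      Abs_fps (\<lambda>t. real (card (chain_partitions ys t))) * fps_X ^ e" (is "?F * _ = ?G * _")
  proof (rule fps_ext)
    fix t
    show "fps_nth (?F * (1 - fps_X)) t = fps_nth (?G * fps_X ^ e) t"
      using card_chain_partitions_snoc[of ys x t] card_chain_partitions_with_max[OF snoc.prems, of t]
      by (auto simp: algebra_simps e_def)
  qed
  then have "?F * (1 - fps_X) ^ (length (ys @ [x]) + 1)
      = ?G * fps_X ^ e * (1 - fps_X) ^ (length ys + 1)"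
    by (simp add: mult.assoc[symmetric])
  also have "\<dots> = fps_X ^ (k + e)"
    using arg_cong[OF k, of "\<lambda>h. h * fps_X ^ e"] by (simp add: power_add mult_ac)
  finally show ?case by blast
qed

lemma finite_distinct_lists: "finite A \<Longrightarrow> finite {xs. distinct xs \<and> set xs = A}"
  by (rule finite_subset[OF _ finite_lists_length_eq[of A "card A"]])
    (auto simp: distinct_card)

text \<open>
  In a list sorted by \<open>precedes f\<close>, the order of the elements is visible from their positions and no longer
  depends on \<open>f\<close>.
\<close>

lemma sorted_wrt_precedes_iff:
  assumes "sorted_wrt (precedes f) xs" "u \<in> set xs" "v \<in> set xs"
  shows "precedes f u v \<longleftrightarrow> (\<exists>i j. i < j \<and> j < length xs \<and> xs ! i = u \<and> xs ! j = v)"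
proof
  assume uv: "precedes f u v"
  obtain i j where ij: "i < length xs" "xs ! i = u" "j < length xs" "xs ! j = v"
    using assms(2,3) by (auto simp: in_set_conv_nth)
  have "i < j"
  proof (rule ccontr)
    assume "\<not> i < j"
    then consider "i = j" | "j < i" by linarith
    then show False
    proof cases
      case 1
      then show False using uv ij by (auto simp: precedes_def)
    next
      case 2
      then have "precedes f v u" using assms(1) ij by (auto simp: sorted_wrt_iff_nth_less)
      then show False using uv precedes_asym by blast
    qed
  qed
  then show "\<exists>i j. i < j \<and> j < length xs \<and> xs ! i = u \<and> xs ! j = v"
    using ij by blast
next
  assume "\<exists>i j. i < j \<and> j < length xs \<and> xs ! i = u \<and> xs ! j = v"
  then show "precedes f u v" using assms(1) by (auto simp: sorted_wrt_iff_nth_less)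
qed

text \<open>
  Every map sorts its arguments into exactly one list, and whether it satisfies the constraints can be
  read off from that list alone. The family \<open>\<L>\<close> consists of the linear extensions of \<open>C\<close>, and it is the
  same for all \<open>t\<close>.
\<close>

lemma p_partitions_eq_UN_chain_partitions:
  assumes "finite A" "C \<subseteq> A \<times> A"
  shows "\<exists>\<L>. finite \<L> \<and> (\<forall>xs\<in>\<L>. distinct xs \<and> set xs = A) \<and>
    (\<forall>t. p_partitions A C t = (\<Union>xs\<in>\<L>. chain_partitions xs t))"
proof -
  define \<L> where "\<L> = {xs. distinct xs \<and> set xs = A \<and>
    (\<forall>(u, v)\<in>C. \<exists>i j. i < j \<and> j < length xs \<and> xs ! i = u \<and> xs ! j = v)}"
  have mem: "xs \<in> \<L> \<longleftrightarrow> (\<forall>(u, v)\<in>C. precedes f u v)"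
    if "distinct xs" "set xs = A" "sorted_wrt (precedes f) xs" for f xs
  proof -
    have "(\<exists>i j. i < j \<and> j < length xs \<and> xs ! i = u \<and> xs ! j = v) = precedes f u v"
      if "(u, v) \<in> C" for u v
      by (rule sym, rule sorted_wrt_precedes_iff) (use that assms(2) \<open>set xs = A\<close>
        \<open>sorted_wrt (precedes f) xs\<close> in auto)
    then have "(\<forall>(u, v)\<in>C. \<exists>i j. i < j \<and> j < length xs \<and> xs ! i = u \<and> xs ! j = v)
        \<longleftrightarrow> (\<forall>(u, v)\<in>C. precedes f u v)"
      by (intro ball_cong) auto
    then show ?thesis using that(1,2) by (simp add: \<L>_def)
  qed
  have "f \<in> (\<Union>xs\<in>\<L>. chain_partitions xs t)" if "f \<in> p_partitions A C t" for f t
  proof -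
    obtain xs where "distinct xs" "set xs = A" "sorted_wrt (precedes f) xs"
      using ex_sorted_wrt_precedes[OF assms(1)] by blast
    then show ?thesis
      using that mem[of xs f] by (auto simp: p_partitions_def chain_partitions_def)
  qed
  moreover have "f \<in> p_partitions A C t" if "xs \<in> \<L>" "f \<in> chain_partitions xs t" for f t xs
  proof -
    have "distinct xs" "set xs = A" using that(1) by (auto simp: \<L>_def)
    then show ?thesis
      using that mem[of xs f] by (auto simp: p_partitions_def chain_partitions_def)
  qed
  ultimately have "p_partitions A C t = (\<Union>xs\<in>\<L>. chain_partitions xs t)" for t
    by blast
  moreover have "finite \<L>"
    by (rule finite_subset[OF _ finite_distinct_lists[OF assms(1)]]) (auto simp: \<L>_def)
  moreover have "\<forall>xs\<in>\<L>. distinct xs \<and> set xs = A" by (auto simp: \<L>_def)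
  ultimately show ?thesis by (intro exI[of _ \<L>]) simp
qed

text \<open>
  Stanley's theorem: the numerator is the sum of \<open>z^des\<close> over the linear extensions, hence has
  nonnegative coefficients.
\<close>

lemma p_partitions_series:
  assumes "finite A" "C \<subseteq> A \<times> A"
  shows "\<exists>h. Abs_fps (\<lambda>t. real (card (p_partitions A C t))) * (1 - fps_X) ^ (card A + 1)
      = fps_of_poly h \<and> (\<forall>k. 0 \<le> coeff h k)"
proof -
  obtain \<L> where L: "finite \<L>" "\<And>xs. xs \<in> \<L> \<Longrightarrow> distinct xs \<and> set xs = A"
    "\<And>t. p_partitions A C t = (\<Union>xs\<in>\<L>. chain_partitions xs t)"
    using p_partitions_eq_UN_chain_partitions[OF assms] by blast
  have "card (p_partitions A C t) = (\<Sum>xs\<in>\<L>. card (chain_partitions xs t))" for t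
    unfolding L(3)
  proof (rule card_UN_disjoint)
    show "\<forall>xs\<in>\<L>. \<forall>ys\<in>\<L>. xs \<noteq> ys \<longrightarrow> chain_partitions xs t \<inter> chain_partitions ys t = {}"
    proof (intro ballI impI equals0I)
      fix xs ys f
      assume "xs \<in> \<L>" "ys \<in> \<L>" "xs \<noteq> ys" and f: "f \<in> chain_partitions xs t \<inter> chain_partitions ys t"
      then have "set xs = set ys" using L(2) by simp
      then show False
        using f \<open>xs \<noteq> ys\<close> sorted_wrt_precedes_unique[of f xs ys] by (simp add: chain_partitions_def)
    qed
  qed (auto simp: L(1) finite_chain_partitions)
  then have series: "Abs_fps (\<lambda>t. real (card (p_partitions A C t)))
      = (\<Sum>xs\<in>\<L>. Abs_fps (\<lambda>t. real (card (chain_partitions xs t))))"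
    by (simp add: fps_eq_iff fps_sum_nth)
  have "\<exists>k. Abs_fps (\<lambda>t. real (card (chain_partitions xs t))) * (1 - fps_X) ^ (card A + 1)
      = fps_X ^ k" if "xs \<in> \<L>" for xs
    using chain_partitions_series[of xs] L(2)[OF that] distinct_card[of xs] by auto
  then obtain k where k: "\<And>xs. xs \<in> \<L> \<Longrightarrow>
      Abs_fps (\<lambda>t. real (card (chain_partitions xs t))) * (1 - fps_X) ^ (card A + 1)
      = fps_X ^ k xs"
    by metis
  have "Abs_fps (\<lambda>t. real (card (p_partitions A C t))) * (1 - fps_X) ^ (card A + 1)
      = (\<Sum>xs\<in>\<L>. fps_X ^ k xs)"
    unfolding series sum_distrib_right using k by simp
  also have "\<dots> = fps_of_poly (\<Sum>xs\<in>\<L>. monom 1 (k xs))"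
    by (simp add: fps_of_poly_sum fps_of_poly_monom)
  finally show ?thesis
    by (intro exI[of _ "\<Sum>xs\<in>\<L>. monom 1 (k xs)"]) (auto simp: coeff_sum intro!: sum_nonneg)
qed

section \<open>Lattice points of dilated order polytopes\<close>

lemma order_polytope_h_star_eqI:
  assumes "Abs_fps (\<lambda>t. real (ehrhart_count A r t)) * (1 - fps_X) ^ (card A + 1) = fps_of_poly h"
  shows "order_polytope_h_star A r = h"
proof -
  have unit: "is_unit ((1 - fps_X :: real fps) ^ (card A + 1))"
    by (simp only: fps_is_unit_iff fps_nth_power_0) simp
  have "Abs_fps (\<lambda>t. real (ehrhart_count A r t)) = fps_of_poly g / (1 - fps_X) ^ (card A + 1)
      \<longleftrightarrow> g = h" for g
    using unit_eq_div2[OF unit] assms by auto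
  then show ?thesis
    unfolding order_polytope_h_star_def by (intro the_equality) auto
qed

lemma monotone_on_trancl:
  fixes x :: "'a \<Rightarrow> 'b::preorder"
  assumes "\<And>a b. (a, b) \<in> C \<Longrightarrow> x a \<le> x b" "(a, b) \<in> C\<^sup>+"
  shows "x a \<le> x b"
  using assms(2)
proof (induction rule: trancl_induct)
  case (step b c)
  then show ?case using assms(1)[of b c] order_trans by blast
qed (rule assms(1))

text \<open>
  Monotonicity along the cover relations suffices for monotonicity on the generated order. A map \<open>f\<close>
  into \<open>{0..t}\<close> is the dilate of \<open>f / t\<close>; for \<open>t = 0\<close> the convention \<open>x / 0 = 0\<close> gives the only lattice
  point, the origin.
\<close>

lemma ehrhart_count_eq_card_p_partitions:
  fixes A :: "'a::linorder set"
  assumes "C \<subseteq> A \<times> A" "\<And>u v. (u, v) \<in> C \<Longrightarrow> v < u"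
  shows "ehrhart_count A (C\<^sup>+) t = card (p_partitions A C t)"
proof -
  have P: "p_partitions A C t = {f \<in> A \<rightarrow>\<^sub>E {..t}. \<forall>(u, v)\<in>C. f u \<le> f v}"
    using assms(2) by (auto simp: p_partitions_def precedes_descending)
  have "bij_betw (\<lambda>f. \<lambda>a\<in>A. real (f a)) (p_partitions A C t)
    (dilate A t (order_polytope A (C\<^sup>+)) \<inter> (A \<rightarrow>\<^sub>E \<int>))" (is "bij_betw ?g _ ?D")
  proof (rule bij_betwI[where g = "\<lambda>y. \<lambda>a\<in>A. nat \<lfloor>y a\<rfloor>"])
    show "?g \<in> p_partitions A C t \<rightarrow> ?D"
    proof
      fix f assume f: "f \<in> p_partitions A C t"
      let ?x = "\<lambda>a\<in>A. real (f a) / real t"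
      have le: "f a \<le> t" if "a \<in> A" for a using f that by (auto simp: P PiE_iff)
      have mono: "f a \<le> f b" if "(a, b) \<in> C\<^sup>+" for a b
        by (rule monotone_on_trancl[OF _ that]) (use f in \<open>auto simp: P\<close>)
      have "?x \<in> order_polytope A (C\<^sup>+)"
        using le mono by (auto simp: order_polytope_def divide_right_mono divide_le_eq)
      moreover have "?g f = (\<lambda>a\<in>A. real t * ?x a)"
        using le by (auto simp: fun_eq_iff)
      ultimately have "?g f \<in> dilate A t (order_polytope A (C\<^sup>+))"
        unfolding dilate_def by blast
      then show "?g f \<in> ?D" by auto
    qed
    show "(\<lambda>y. \<lambda>a\<in>A. nat \<lfloor>y a\<rfloor>) \<in> ?D \<rightarrow> p_partitions A C t"
    proof
      fix y assume y: "y \<in> ?D"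
      then obtain x where x: "x \<in> order_polytope A (C\<^sup>+)" "y = (\<lambda>a\<in>A. real t * x a)"
        by (auto simp: dilate_def)
      have "y a \<le> real t" if "a \<in> A" for a
        using x that by (auto simp: order_polytope_def PiE_iff intro: mult_left_le)
      then have "nat \<lfloor>y a\<rfloor> \<le> t" if "a \<in> A" for a
        using that by (force simp: nat_le_iff floor_le_iff intro: le_less_trans[of _ "real t"])
      moreover have "y a \<le> y b" if "(a, b) \<in> C" for a b
        using x that assms(1) r_into_trancl[OF that]
        by (auto simp: order_polytope_def intro!: mult_left_mono)
      ultimately show "(\<lambda>a\<in>A. nat \<lfloor>y a\<rfloor>) \<in> p_partitions A C t"
        using assms(1) by (auto simp: P intro!: nat_mono floor_mono)
    qed
    show "(\<lambda>a\<in>A. nat \<lfloor>?g f a\<rfloor>) = f" if "f \<in> p_partitions A C t" for f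
      using that by (auto simp: P PiE_iff extensional_def fun_eq_iff)
    show "?g (\<lambda>a\<in>A. nat \<lfloor>y a\<rfloor>) = y" if y: "y \<in> ?D" for y
    proof
      fix a
      obtain x where x: "x \<in> order_polytope A (C\<^sup>+)" "y = (\<lambda>a\<in>A. real t * x a)"
        using y by (auto simp: dilate_def)
      show "?g (\<lambda>a\<in>A. nat \<lfloor>y a\<rfloor>) a = y a"
      proof (cases "a \<in> A")
        case True
        then have "y a \<in> \<int>" "0 \<le> y a"
          using y x by (auto simp: order_polytope_def PiE_iff)
        then show ?thesis using True by (auto elim!: Ints_cases)
      next
        case False
        then show ?thesis using x by auto
      qed
    qed
  qed
  then show ?thesis
    unfolding ehrhart_count_def by (simp add: bij_betw_same_card)
qed

section \<open>Exchanging two elements\<close>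

lemma p_partitions_comp_transpose:
  assumes "a \<in> A" "b \<in> A" "f \<in> A \<rightarrow>\<^sub>E T"
  shows "f \<circ> transpose a b \<in> A \<rightarrow>\<^sub>E T"
  using assms by (auto simp: PiE_iff extensional_def transpose_def)

lemma card_p_partitions_transpose:
  fixes A :: "'a::linorder set"
  assumes "a \<in> A" "b \<in> A"
    and descending: "\<And>u v. (u, v) \<in> C \<Longrightarrow> v < u" "\<And>u v. (u, v) \<in> C' \<Longrightarrow> v < u"
    and C: "\<And>u v. (u, v) \<in> C \<Longrightarrow> (transpose a b u, transpose a b v) \<in> C'"
    and C': "\<And>u v. (u, v) \<in> C' \<Longrightarrow> (transpose a b u, transpose a b v) \<in> C"
  shows "card (p_partitions A C t) = card (p_partitions A C' t)"
proof -
  have P: "p_partitions A C t = {f \<in> A \<rightarrow>\<^sub>E {..t}. \<forall>(u, v)\<in>C. f u \<le> f v}"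
    "p_partitions A C' t = {f \<in> A \<rightarrow>\<^sub>E {..t}. \<forall>(u, v)\<in>C'. f u \<le> f v}"
    using descending by (auto simp: p_partitions_def precedes_descending)
  have "bij_betw (\<lambda>f. f \<circ> transpose a b) (p_partitions A C t) (p_partitions A C' t)"
  proof (rule bij_betwI[where g = "\<lambda>f. f \<circ> transpose a b"])
    have "f \<circ> transpose a b \<in> p_partitions A C' t" if f: "f \<in> p_partitions A C t" for f
    proof -
      have "f (transpose a b u) \<le> f (transpose a b v)" if "(u, v) \<in> C'" for u v
        using f C'[OF that] by (auto simp: P)
      then show ?thesis
        using f p_partitions_comp_transpose[OF assms(1,2), of f "{..t}"] by (auto simp: P)
    qed
    then show "(\<lambda>f. f \<circ> transpose a b) \<in> p_partitions A C t \<rightarrow> p_partitions A C' t" by blast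
    have "f \<circ> transpose a b \<in> p_partitions A C t" if f: "f \<in> p_partitions A C' t" for f
    proof -
      have "f (transpose a b u) \<le> f (transpose a b v)" if "(u, v) \<in> C" for u v
        using f C[OF that] by (auto simp: P)
      then show ?thesis
        using f p_partitions_comp_transpose[OF assms(1,2), of f "{..t}"] by (auto simp: P)
    qed
    then show "(\<lambda>f. f \<circ> transpose a b) \<in> p_partitions A C' t \<rightarrow> p_partitions A C t" by blast
  qed (auto simp: comp_assoc)
  then show ?thesis by (rule bij_betw_same_card)
qed

text \<open>
  The elements \<open>a\<close> and \<open>b\<close> are interchangeable for the constraints in \<open>B\<close>, and the relation \<open>a \<prec> q\<close>
  is all that tells them apart. The lemma measures what is lost when \<open>c\<close> is moved from below \<open>b\<close> to
  below \<open>a\<close>. Where \<open>f b \<le> f q\<close>, exchanging the values of \<open>a\<close> and \<open>b\<close> shows that nothing is lost; elsewhere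
  \<open>f a < f b\<close>, and \<open>f c \<le> f a\<close> is the stronger requirement. The last set of constraints describes
  the difference: since \<open>q < b\<close> and \<open>a < c\<close> are numerically increasing, they are read as strict
  inequalities.
\<close>

lemma card_p_partitions_exchange:
  fixes A :: "'a::linorder set"
  assumes "finite A"
    and descending: "\<And>u v. (u, v) \<in> B \<Longrightarrow> v < u"
    and invariant: "\<And>u v. (u, v) \<in> B \<Longrightarrow> (transpose a b u, transpose a b v) \<in> B"
    and ab: "a \<in> A" "b \<in> A" and order: "q < a" "q < b" "a < c" "b < c"
  shows "card (p_partitions A (B \<union> {(a, q), (c, b)}) t) =
    card (p_partitions A (B \<union> {(a, q), (c, a)}) t)
    + card (p_partitions A (B \<union> {(a, q), (c, b), (q, b), (a, c)}) t)"
    (is "card ?X = card ?Y + card ?D")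
proof -
  let ?low = "{f. f b \<le> f q}"
  define F where "F = {f \<in> A \<rightarrow>\<^sub>E {..t}. \<forall>(u, v)\<in>B. f u \<le> f v}"
  have X: "?X = {f \<in> F. f a \<le> f q \<and> f c \<le> f b}"
    and Y: "?Y = {f \<in> F. f a \<le> f q \<and> f c \<le> f a}"
    and D: "?D = {f \<in> F. f a \<le> f q \<and> f c \<le> f b \<and> f q < f b \<and> f a < f c}"
    using descending order
    by (auto simp: F_def p_partitions_def precedes_descending precedes_ascending)
  have fixed: "transpose a b q = q" "transpose a b c = c"
    using order by (auto simp: transpose_def)
  have swap: "f \<circ> transpose a b \<in> F" if "f \<in> F" for f
  proof -
    have "f (transpose a b u) \<le> f (transpose a b v)" if "(u, v) \<in> B" for u v
      using \<open>f \<in> F\<close> invariant[OF that] by (auto simp: F_def)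
    then show ?thesis
      using that p_partitions_comp_transpose[OF ab, of f "{..t}"] by (auto simp: F_def)
  qed
  have "bij_betw (\<lambda>f. f \<circ> transpose a b) (?X \<inter> ?low) (?Y \<inter> ?low)"
    unfolding X Y
    by (rule bij_betwI[where g = "\<lambda>f. f \<circ> transpose a b"])
      (auto simp: fixed swap comp_assoc)
  then have low: "card (?X \<inter> ?low) = card (?Y \<inter> ?low)"
    by (rule bij_betw_same_card)
  have "?X - ?low = (?Y - ?low) \<union> ?D" "(?Y - ?low) \<inter> ?D = {}"
    unfolding X Y D by auto
  then have "card (?X - ?low) = card (?Y - ?low) + card ?D"
    using \<open>finite A\<close> by (simp add: card_Un_disjoint finite_p_partitions)
  then show ?thesis
    using low card_Int_Diff[of ?X ?low] card_Int_Diff[of ?Y ?low] \<open>finite A\<close>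
    by (simp add: finite_p_partitions)
qed

section \<open>Cover relations of snake posets\<close>

text \<open>
  The cover relations of a snake poset in closed form: \<open>g k\<close> is the element below which \<open>2*k + 2\<close> is
  hung. With \<open>g 0 = 0\<close> the initial diamond also fits the pattern, except for its relation
  \<open>1 \<prec> 0\<close>.
\<close>

definition snake_relations :: "(nat \<Rightarrow> nat) \<Rightarrow> nat \<Rightarrow> (nat \<times> nat) set" where
  "snake_relations g n =
     {(1, 0)} \<union> (\<Union>k\<in>{..n}. {(2*k + 3, 2*k + 1), (2*k + 3, 2*k + 2), (2*k + 2, g k)})"

definition attachment :: "letter list \<Rightarrow> nat \<Rightarrow> nat" where
  "attachment v k =
     (if (k = 1 \<and> v ! 1 = L) \<or> (2 \<le> k \<and> v ! (k - 1) \<noteq> v ! k) then 2*k - 1 else 2*k)"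

lemma attachment_cases: "attachment v k \<in> {2*k - 1, 2*k}"
  by (simp add: attachment_def)

lemma snake_relations_cong:
  "(\<And>k. k \<le> n \<Longrightarrow> g k = g' k) \<Longrightarrow> snake_relations g n = snake_relations g' n"
  by (auto simp: snake_relations_def)

lemma mem_snake_relations_iff:
  "(u, v) \<in> snake_relations g n \<longleftrightarrow> (u, v) = (1, 0) \<or>
     (\<exists>k\<le>n. u = 2*k + 3 \<and> (v = 2*k + 1 \<or> v = 2*k + 2) \<or> u = 2*k + 2 \<and> v = g k)"
  by (auto simp: snake_relations_def)

lemma snake_relationsE:
  assumes "(u, v) \<in> snake_relations g n"
  obtains "u = 1" "v = 0"
  | k where "k \<le> n" "u = 2*k + 3" "v = 2*k + 1 \<or> v = 2*k + 2"
  | k where "k \<le> n" "u = 2*k + 2" "v = g k"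
  using assms unfolding mem_snake_relations_iff by blast

lemma snake_relations_subset:
  assumes "\<And>k. g k \<in> {2*k - 1, 2*k}"
  shows "snake_relations g n \<subseteq> {..2*n + 3} \<times> {..2*n + 3}"
proof -
  have "g k \<le> 2*n + 3" if "k \<le> n" for k using assms[of k] that by auto
  then show ?thesis by (auto simp: snake_relations_def)
qed

lemma snake_relations_descending:
  assumes "\<And>k. g k \<in> {2*k - 1, 2*k}" "(u, v) \<in> snake_relations g n"
  shows "v < u"
  using assms(2)
proof (cases rule: snake_relationsE)
  case (3 k)
  then show ?thesis using assms(1)[of k] by auto
qed auto

lemma snake_covers_eq:
  assumes "gen_snake_word n v" "m \<le> n"
  shows "snake_covers v m = snake_relations (attachment v) m"
  using assms(2)
proof (induction m)
  case 0
  then show ?case by (auto simp: snake_relations_def attachment_def)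
next
  case (Suc m)
  have letters: "v ! k = L \<or> v ! k = R" if "1 \<le> k" "k \<le> n" for k
    using assms(1) that by (auto simp: gen_snake_word_def)
  let ?k = "Suc m"
  have "snake_covers v ?k = snake_covers v m \<union>
      {(2*?k + 3, 2*?k + 1), (2*?k + 3, 2*?k + 2), (2*?k + 2, attachment v ?k)}"
    using letters[of m] letters[of ?k] Suc.prems
    by (cases "m = 0") (auto simp: attachment_def Let_def)
  also have "snake_covers v m = snake_relations (attachment v) m"
    using Suc by simp
  finally show ?case by (simp add: snake_relations_def atMost_Suc)
qed

lemma snake_elements_eq: "snake_elements n = {..2*n + 3}"
  by (induction n) (auto simp: Let_def)

lemma h_star_series:
  assumes "gen_snake_word n w"
  shows "Abs_fps (\<lambda>t. real (card (p_partitions {..2*n + 3} (snake_relations (attachment w) n) t)))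
    * (1 - fps_X) ^ (2*n + 5) = fps_of_poly (h_star w)"
proof -
  let ?A = "{..2*n + 3}" and ?C = "snake_relations (attachment w) n"
  have n: "length w - 1 = n" using assms by (simp add: gen_snake_word_def)
  have C: "?C \<subseteq> ?A \<times> ?A" "\<And>u v. (u, v) \<in> ?C \<Longrightarrow> v < u"
    using snake_relations_subset snake_relations_descending attachment_cases by metis+
  have less: "snake_less w = ?C\<^sup>+" and carrier: "snake_carrier w = ?A"
    using snake_covers_eq[OF assms] n
    by (simp_all add: snake_less_def snake_carrier_def snake_elements_eq)
  obtain h where h: "Abs_fps (\<lambda>t. real (card (p_partitions ?A ?C t)))
      * (1 - fps_X) ^ (card ?A + 1) = fps_of_poly h"
    using p_partitions_series[of ?A ?C] C by auto
  then have "h_star w = h"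
    unfolding h_star_def less carrier
    by (intro order_polytope_h_star_eqI) (simp add: ehrhart_count_eq_card_p_partitions[OF C])
  then show ?thesis using h by (simp add: add.commute)
qed

text \<open>
  Moving \<open>c\<close> in a snake poset is an instance of the exchange above. The element \<open>b\<close> hangs below one of
  \<open>2*m - 3\<close> and \<open>2*m - 2\<close>; this one is \<open>p\<close>, the other is \<open>q\<close>. As \<open>a\<close> is covered by both, the
  relation \<open>a \<prec> q\<close> is the one without a counterpart for \<open>b\<close>.
\<close>

lemma snake_relations_exchange:
  assumes g: "\<And>k. g k \<in> {2*k - 1, 2*k}" and m: "2 \<le> m" "m \<le> n" "g m = 2*m"
  obtains D where "D \<subseteq> {..2*n + 3} \<times> {..2*n + 3}"
    and "\<And>t. card (p_partitions {..2*n + 3} (snake_relations g n) t) =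
      card (p_partitions {..2*n + 3} (snake_relations (g(m := 2*m - 1)) n) t)
      + card (p_partitions {..2*n + 3} D t)"
    and "p_partitions {..2*n + 3} D 1 \<noteq> {}"
proof -
  define a b c p where abcp: "a = 2*m - 1" "b = 2*m" "c = 2*m + 2" "p = g (m - 1)"
  define q where "q = (if p = 2*m - 2 then 2*m - 3 else 2*m - 2)"
  have p: "p = 2*m - 3 \<or> p = 2*m - 2"
    using g[of "m - 1"] m(1) by (auto simp: abcp)
  define B where "B = snake_relations g n - {(a, q), (c, b)}"
  define D where "D = B \<union> {(a, q), (c, b), (q, b), (a, c)}"
  have order: "q < a" "q < b" "a < c" "b < c" "c \<le> 2*n + 3"
    using m by (auto simp: abcp q_def)
  have aq: "(a, q) \<in> snake_relations g n" "(a, q) \<in> snake_relations (g(m := 2*m - 1)) n"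
  proof -
    have "m - 2 \<le> n" "a = 2*(m - 2) + 3" "q = 2*(m - 2) + 1 \<or> q = 2*(m - 2) + 2"
      using m p by (auto simp: abcp(1) q_def)
    then show "(a, q) \<in> snake_relations g n" "(a, q) \<in> snake_relations (g(m := 2*m - 1)) n"
      unfolding mem_snake_relations_iff by blast+
  qed
  have cb: "(c, b) \<in> snake_relations g n"
    using m by (auto simp: mem_snake_relations_iff abcp)
  have L: "snake_relations g n = B \<union> {(a, q), (c, b)}"
    using aq(1) cb by (auto simp: B_def)
  have lower_pair: "(u, v) \<in> snake_relations (g(m := 2*m - 1)) n \<longleftrightarrow>
      (u, v) = (c, a) \<or> (u, v) \<in> snake_relations g n \<and> (u, v) \<noteq> (c, b)" for u v
  proof (cases "u = c")
    case True
    have "2*m + 2 \<noteq> 2*k + 3" for k by presburger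
    then show ?thesis using True m by (auto simp: mem_snake_relations_iff abcp)
  next
    case False
    then show ?thesis by (auto simp: mem_snake_relations_iff abcp)
  qed
  have R: "snake_relations (g(m := 2*m - 1)) n = B \<union> {(a, q), (c, a)}"
  proof (rule set_eqI)
    fix x
    show "x \<in> snake_relations (g(m := 2*m - 1)) n \<longleftrightarrow> x \<in> B \<union> {(a, q), (c, a)}"
      using aq(1) order lower_pair[of "fst x" "snd x"] by (cases x) (auto simp: B_def)
  qed
  \<comment> \<open>Apart from the removed pairs, \<open>a\<close> and \<open>b\<close> have the same neighbours, \<open>p\<close> above and
    \<open>2*m + 1\<close> below. This makes \<open>B\<close> invariant.\<close>
  have touching: "(u, v) \<in> {(a, p), (b, p), (2*m + 1, a), (2*m + 1, b)}"
    if uv: "(u, v) \<in> B" "u \<in> {a, b} \<or> v \<in> {a, b}" for u v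
  proof -
    have "(u, v) \<in> snake_relations g n" and ne: "(u, v) \<noteq> (a, q)" "(u, v) \<noteq> (c, b)"
      using uv(1) by (auto simp: B_def)
    then show ?thesis
    proof (cases rule: snake_relationsE)
      case 1
      then show ?thesis using uv(2) m(1) by (auto simp: abcp)
    next
      case (2 k)
      have "k = m - 2 \<and> u = a \<or> k = m - 1"
        using 2 uv(2) m(1) by (auto simp: abcp)
      then show ?thesis
      proof
        assume k: "k = m - 2 \<and> u = a"
        then have "v = 2*m - 3 \<or> v = 2*m - 2" using 2 m(1) by auto
        then have "v = p" using p ne(1) k m(1) by (auto simp: q_def split: if_splits)
        with k show ?thesis by simp
      next
        assume "k = m - 1"
        then have "u = 2*m + 1" "v = a \<or> v = b" using 2 m(1) by (auto simp: abcp(1,2))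
        then show ?thesis by auto
      qed
    next
      case (3 k)
      have "k = m - 1 \<or> k = m"
        using 3 uv(2) m(1) g[of k] by (auto simp: abcp)
      then show ?thesis
      proof
        assume "k = m - 1"
        then have "u = b" "v = p" using 3 m(1) by (auto simp: abcp)
        then show ?thesis by simp
      next
        assume "k = m"
        then show ?thesis using 3 m(3) ne(2) by (simp add: abcp(2,3))
      qed
    qed
  qed
  have below: "(2*m + 1, a) \<in> B" "(2*m + 1, b) \<in> B"
  proof -
    have "m - 1 \<le> n" "2*m + 1 = 2*(m - 1) + 3" "a = 2*(m - 1) + 1" "b = 2*(m - 1) + 2"
      using m by (auto simp: abcp(1,2))
    then have "(2*m + 1, a) \<in> snake_relations g n" "(2*m + 1, b) \<in> snake_relations g n"
      unfolding mem_snake_relations_iff by blast+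
    then show "(2*m + 1, a) \<in> B" "(2*m + 1, b) \<in> B"
      using m by (auto simp: B_def abcp(1-3))
  qed
  have above: "(a, p) \<in> B" "(b, p) \<in> B"
  proof -
    have "p \<noteq> q" using p m(1) by (auto simp: q_def)
    moreover have "(a, p) \<in> snake_relations g n"
    proof -
      have "m - 2 \<le> n" "a = 2*(m - 2) + 3" "p = 2*(m - 2) + 1 \<or> p = 2*(m - 2) + 2"
        using m p by (auto simp: abcp(1))
      then show ?thesis unfolding mem_snake_relations_iff by blast
    qed
    moreover have "(b, p) \<in> snake_relations g n"
    proof -
      have "m - 1 \<le> n" "b = 2*(m - 1) + 2" using m by (auto simp: abcp(2))
      then show ?thesis unfolding mem_snake_relations_iff abcp(4) by blast
    qed
    ultimately show "(a, p) \<in> B" "(b, p) \<in> B"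
      using order by (auto simp: B_def)
  qed
  have invariant: "(transpose a b u, transpose a b v) \<in> B" if "(u, v) \<in> B" for u v
  proof (cases "u \<in> {a, b} \<or> v \<in> {a, b}")
    case True
    have "a \<noteq> p" "b \<noteq> p" "a \<noteq> 2*m + 1" "b \<noteq> 2*m + 1"
      using p m(1) by (auto simp: abcp(1,2))
    then show ?thesis
      using touching[OF that True] above below by (auto simp: transpose_def)
  qed (use that in \<open>auto simp: transpose_def\<close>)
  have "card (p_partitions {..2*n + 3} (snake_relations g n) t) =
      card (p_partitions {..2*n + 3} (snake_relations (g(m := 2*m - 1)) n) t)
      + card (p_partitions {..2*n + 3} D t)" for t
    unfolding L R D_def
  proof (rule card_p_partitions_exchange)
    show "v < u" if "(u, v) \<in> B" for u v
      using that snake_relations_descending[OF g] by (auto simp: B_def)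
  qed (use order invariant in auto)
  moreover have "D \<subseteq> {..2*n + 3} \<times> {..2*n + 3}"
    using snake_relations_subset[OF g, of n] order by (auto simp: D_def B_def)
  moreover have "p_partitions {..2*n + 3} D 1 \<noteq> {}"
  proof -
    \<comment> \<open>The strict relations force the values 0 on \<open>q\<close> and \<open>a\<close> and 1 on \<open>b\<close> and \<open>c\<close>. The set \<open>U\<close> is the
      smallest upper set that contains \<open>b\<close> and \<open>c\<close>, completed by all elements that precede
      \<open>2*m - 3\<close> numerically; it avoids \<open>q\<close> and \<open>a\<close>, and its indicator function lies in the surplus.\<close>
    define U where "U = {..2*m - 4} \<union> {p, b, c}"
    define f where "f = (\<lambda>e\<in>{..2*n + 3}. of_bool (e \<in> U) :: nat)"
    have up_closed: "v \<in> U" if uv: "(u, v) \<in> snake_relations g n" "u \<in> U" for u v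
    proof -
      obtain j where j: "m = j + 2" using m(1) by (metis add.commute le_Suc_ex)
      have vals: "b = 2*j + 4" "c = 2*j + 6" "p = 2*j + 1 \<or> p = 2*j + 2"
        using p by (auto simp: j abcp(2,3))
      have U: "x \<in> U \<longleftrightarrow> x \<le> 2*j \<or> x = p \<or> x = b \<or> x = c" for x
        by (auto simp: U_def j)
      from uv(1) show ?thesis
      proof (cases rule: snake_relationsE)
        case 1
        then show ?thesis by (simp add: U)
      next
        case (2 k)
        have "u \<noteq> b" "u \<noteq> c" "u \<noteq> 2*j + 2" unfolding 2(2) vals(1,2) by presburger+
        then have "u \<le> 2*j + 1" using uv(2) vals(3) unfolding U by auto
        then have "v \<le> 2*j" using 2 by linarith
        then show ?thesis by (simp add: U)
      next
        case (3 k)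
        have "k \<le> j \<or> k = j + 1 \<or> k = j + 2"
          using uv(2) vals 3(2) unfolding U by linarith
        then consider "k \<le> j" | "k = m - 1" | "k = m" unfolding j by linarith
        then show ?thesis
        proof cases
          case 1
          then have "v \<le> 2*j" using 3 g[of k] by auto
          then show ?thesis by (simp add: U)
        next
          case 2
          then show ?thesis using 3(3) by (simp add: U abcp(4))
        next
          case k: 3
          then show ?thesis using 3(3) m(3) by (simp add: U abcp(2))
        qed
      qed
    qed
    have at: "f q = 0" "f a = 0" "f p = 1" "f b = 1" "f c = 1"
    proof -
      have "q \<notin> U" "a \<notin> U" "p \<in> U" "b \<in> U" "c \<in> U"
        using order p m(1) by (auto simp: U_def abcp(1-3) q_def)
      moreover have "p \<le> 2*n + 3" using p order by (auto simp: abcp(2))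
      ultimately show "f q = 0" "f a = 0" "f p = 1" "f b = 1" "f c = 1"
        using order by (simp_all add: f_def)
    qed
    have "precedes f u v" if uv: "(u, v) \<in> D" for u v
    proof -
      consider "(u, v) = (q, b)" | "(u, v) = (a, c)" | "(u, v) \<in> snake_relations g n"
        using uv unfolding D_def L by blast
      then show ?thesis
      proof cases
        case 3
        have "f u = 0 \<or> f v = 1"
          using up_closed[OF 3] snake_relations_subset[OF g, of n] 3 by (auto simp: f_def)
        moreover have "v < u" using snake_relations_descending[OF g 3] .
        moreover have "f u \<le> 1"
          using snake_relations_subset[OF g, of n] 3 by (auto simp: f_def)
        ultimately show ?thesis by (auto simp: precedes_descending)
      qed (use at order in \<open>auto simp: precedes_ascending\<close>)
    qed
    then have "f \<in> p_partitions {..2*n + 3} D 1"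
      by (auto simp: p_partitions_def f_def)
    then show ?thesis by blast
  qed
  ultimately show thesis using that by blast
qed

section \<open>The swap operation on words\<close>

lemma swap_nth: "j < length w \<Longrightarrow> swap i w ! j = (if i \<le> j + 1 then flip_letter (w ! j) else w ! j)"
  by (simp add: swap_def letter_at_def del: upt_Suc)

lemma length_swap: "length (swap i w) = length w"
  by (simp add: swap_def del: upt_Suc)

lemma flip_letter_eq_iff: "flip_letter x = flip_letter y \<longleftrightarrow> x = y"
  by (cases x; cases y) auto

lemma flip_letter_neq: "x \<in> {L, R} \<Longrightarrow> flip_letter x \<noteq> x"
  by auto

lemma gen_snake_word_swap:
  assumes "gen_snake_word n w"
  shows "gen_snake_word n (swap i w)"
  using assms by (fastforce simp: gen_snake_word_def length_swap swap_nth)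

text \<open>
  Two letters that are both flipped, or both kept, agree after the swap iff they agreed before. Only the pair
  of letters of index \<open>i - 1\<close> and \<open>i\<close> is separated, and \<open>i \<ge> 3\<close> keeps it away from the special rule for \<open>k = 1\<close>.
\<close>

lemma attachment_swap:
  assumes w: "gen_snake_word n w" and i: "3 \<le> i" "i \<le> n + 1" "w ! (i - 2) = w ! (i - 1)" and "k \<le> n"
  shows "attachment (swap i w) k = ((attachment w)(i - 1 := 2*(i - 1) - 1)) k"
proof -
  have "i - 1 \<in> {1..n}" using i by auto
  then have len: "length w = n + 1" and "w ! (i - 1) \<in> {L, R}"
    using w unfolding gen_snake_word_def by blast+
  then have neq: "flip_letter (w ! (i - 1)) \<noteq> w ! (i - 1)" by (intro flip_letter_neq)
  show ?thesis
  proof (cases "k = i - 1")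
    case True
    then have "k - 1 = i - 2" "2 \<le> k" using i by auto
    then show ?thesis
      using True neq len i \<open>k \<le> n\<close> by (auto simp: attachment_def swap_nth)
  next
    case False
    then have "i \<le> k \<or> k < i - 1" using i by linarith
    then show ?thesis
      using False len i \<open>k \<le> n\<close> by (auto simp: attachment_def swap_nth flip_letter_eq_iff)
  qed
qed

text \<open>
  The elements 1 and 2 are the two sides of the initial diamond; the choice of the side below which 4 is hung
  is immaterial.
\<close>

lemma snake_relations_transpose:
  assumes g: "\<And>k. g k \<in> {2*k - 1, 2*k}" and g': "g' 0 = 0"
    "\<And>k. 2 \<le> k \<Longrightarrow> k \<le> n \<Longrightarrow> g' k = g k" "1 \<le> n \<Longrightarrow> g' 1 = 3 - g 1"
    and uv: "(u, v) \<in> snake_relations g n"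
  shows "(transpose 1 2 u, transpose 1 2 v) \<in> snake_relations g' n"
  using uv
proof (cases rule: snake_relationsE)
  case 1
  then show ?thesis using g'(1) by (auto simp: mem_snake_relations_iff)
next
  case (2 k)
  then show ?thesis
    by (cases "k = 0") (auto simp: mem_snake_relations_iff transpose_def)
next
  case (3 k)
  consider "k = 0" | "k = 1" | "2 \<le> k" by linarith
  then show ?thesis
  proof cases
    case 1
    then have "transpose 1 2 u = 1" "transpose 1 2 v = 0"
      using 3 g[of 0] by (auto simp: transpose_def)
    then show ?thesis by (simp add: mem_snake_relations_iff)
  next
    case 2
    then show ?thesis
      using 3 g[of 1] g'(3) by (auto simp: mem_snake_relations_iff transpose_def intro!: exI[of _ 1])
  next
    case k: 3
    then have "2 < v" using 3 g[of k] by auto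
    then show ?thesis
      using 3 k g'(2)[of k] by (auto simp: mem_snake_relations_iff transpose_def)
  qed
qed

lemma h_star_swap_one:
  assumes w: "gen_snake_word n w"
  shows "h_star (swap 1 w) = h_star w"
proof -
  let ?A = "{..2*n + 3}" and ?g = "attachment w" and ?g' = "attachment (swap 1 w)"
  have len: "length w = n + 1" and letters: "\<And>k. 1 \<le> k \<Longrightarrow> k \<le> n \<Longrightarrow> w ! k \<in> {L, R}"
    using w by (auto simp: gen_snake_word_def)
  have later: "?g' k = ?g k" if "2 \<le> k" "k \<le> n" for k
    using that len by (auto simp: attachment_def swap_nth flip_letter_eq_iff)
  have first: "?g' 1 = 3 - ?g 1" "?g 1 = 3 - ?g' 1" if "1 \<le> n"
    using that len letters[of 1] by (auto simp: attachment_def swap_nth)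
  have zero: "?g 0 = 0" "?g' 0 = 0" by (auto simp: attachment_def)
  have "card (p_partitions ?A (snake_relations ?g n) t)
      = card (p_partitions ?A (snake_relations ?g' n) t)" for t
  proof (rule card_p_partitions_transpose[of 1 _ 2])
    show "(transpose 1 2 u, transpose 1 2 v) \<in> snake_relations ?g' n"
      if "(u, v) \<in> snake_relations ?g n" for u v
      using snake_relations_transpose[OF attachment_cases _ _ _ that] zero later first by blast
    show "(transpose 1 2 u, transpose 1 2 v) \<in> snake_relations ?g n"
      if "(u, v) \<in> snake_relations ?g' n" for u v
      using snake_relations_transpose[OF attachment_cases _ _ _ that] zero later first by metis
  qed (use snake_relations_descending[OF attachment_cases] in auto)
  then have "fps_of_poly (h_star w) = fps_of_poly (h_star (swap 1 w))"
    using h_star_series[OF w] h_star_series[OF gen_snake_word_swap[OF w], of 1] by simp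
  then show ?thesis by simp
qed

section \<open>Comparison of the polynomials\<close>

theorem theorem4p19:
  fixes w :: "letter list" and n i :: nat
  assumes "gen_snake_word n w" and "n > 0"
    and "1 \<le> i" and "i \<le> n + 1"
    and "i = 1 \<or> letter_at w (i - 1) = letter_at w i"
  shows "(\<forall>k. coeff (h_star (swap i w)) k \<le> coeff (h_star w) k)
         \<and> (h_star (swap i w) = h_star w \<longleftrightarrow> i = 1)"
proof (cases "i = 1")
  case True
  then show ?thesis using h_star_swap_one[OF assms(1)] by simp
next
  case False
  then have eq: "w ! (i - 2) = w ! (i - 1)"
    using assms(5) by (simp add: letter_at_def numeral_2_eq_2)
  have "w ! 0 \<noteq> w ! 1"
    using assms(1,2) by (force simp: gen_snake_word_def)
  then have "i \<noteq> 2" using eq by auto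
  then have i: "3 \<le> i" using False assms(3) by linarith
  define m where "m = i - 1"
  have m: "2 \<le> m" "m \<le> n" "attachment w m = 2*m"
    using i assms(4) eq by (auto simp: m_def attachment_def diff_diff_left numeral_2_eq_2)
  let ?A = "{..2*n + 3}" and ?count = "\<lambda>C. Abs_fps (\<lambda>t. real (card (p_partitions {..2*n + 3} C t)))"
  obtain D where D: "D \<subseteq> ?A \<times> ?A" "p_partitions ?A D 1 \<noteq> {}"
    "\<And>t. card (p_partitions ?A (snake_relations (attachment w) n) t) =
      card (p_partitions ?A (snake_relations ((attachment w)(m := 2*m - 1)) n) t)
      + card (p_partitions ?A D t)"
    using snake_relations_exchange[OF attachment_cases m] by metis
  obtain h where h: "?count D * (1 - fps_X) ^ (2*n + 5) = fps_of_poly h" "\<forall>k. 0 \<le> coeff h k"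
    using p_partitions_series[OF finite_atMost D(1)] by (simp add: add.commute) blast
  have "snake_relations (attachment (swap i w)) n = snake_relations ((attachment w)(m := 2*m - 1)) n"
    using attachment_swap[OF assms(1) i assms(4) eq] by (intro snake_relations_cong) (simp add: m_def)
  then have "?count (snake_relations (attachment w) n)
      = ?count (snake_relations (attachment (swap i w)) n) + ?count D"
    by (simp add: fps_eq_iff D(3))
  then have "fps_of_poly (h_star w) = fps_of_poly (h_star (swap i w) + h)"
    using h(1) h_star_series[OF assms(1)] h_star_series[OF gen_snake_word_swap[OF assms(1)], of i]
    by (simp add: fps_of_poly_add distrib_right)
  then have sum: "h_star w = h_star (swap i w) + h" by simp
  \<comment> \<open>The surplus is nonempty already for \<open>t = 1\<close>, so the difference \<open>h\<close> of the polynomials is not zero.\<close>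
  have "fps_nth (?count D) 1 \<noteq> 0"
    using D(2) by (simp add: finite_p_partitions)
  then have "?count D \<noteq> 0" by (metis fps_zero_nth)
  moreover have "(1 - fps_X :: real fps) ^ (2*n + 5) \<noteq> 0"
  proof -
    have "fps_nth ((1 - fps_X :: real fps) ^ (2*n + 5)) 0 = 1"
      by (simp only: fps_nth_power_0) simp
    then show ?thesis by auto
  qed
  ultimately have "h \<noteq> 0" using h(1) by auto
  then show ?thesis using sum h(2) False by simp
qed

end
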